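(* The following hold for subsets of $\mathbb R^N$: (i) A set $\mathcal P$ is CP admissible if and only if $\lambda\mathcal P$ is CP admissible for any real number $\lambda\ne 0$; and the intersection and the union of CP admissible sets are CP admissible; (ii) the algebraic (Minkowski) sum of two CP admissible sets is CP admissible; (iii) if $\mathcal P$ is CP admissible, then for any index set $\mathcal I\subseteq\{1,\dots,N\}$, $\pi_{\mathcal I}(\mathcal P)$ is also CP admissible; (iv) if $\mathcal P$ is a convex and CP admissible set, then $\dim(\mathcal P)=\max\{|\mathrm{supp}(x)| : x\in\mathcal P\}$.
   Context: For $x\in\mathbb R^N$, $\mathrm{supp}(x)=\{i: x_i\ne0\}$. For an index set $\mathcal I\subseteq\{1,\dots,N\}$, the coordinate projection $\pi_{\mathcal I}:\mathbb R^N\to\mathbb R^N$ is defined by $(\pi_{\mathcal I}(x))_i=x_i$ for $i\in\mathcal I$ and $(\pi_{\mathcal I}(x))_i=0$ for $i\notin\mathcal I$. A nonempty set $\mathcal P\subseteq\mathbb R^N$ is coordinate projection admissible (CP admissible) if for any $x\in\mathcal P$ and any index set $\mathcal J\subseteq\mathrm{supp}(x)$ (possibly empty), $\pi_{\mathcal J}(x)\in\mathcal P$. The dimension $\dim(\mathcal P)$ of a convex set is the dimension of its affine hull. *)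

theory Defs
  imports "HOL-Analysis.Analysis" "HOL-Library.Set_Algebras"
begin

definition supp :: "real ^ 'n \<Rightarrow> 'n set"
  where "supp x = {i. x $ i \<noteq> 0}"

definition coord_proj :: "'n set \<Rightarrow> real ^ 'n \<Rightarrow> real ^ 'n"
  where "coord_proj I x = (\<chi> i. if i \<in> I then x $ i else 0)"

definition cp_admissible :: "(real ^ 'n) set \<Rightarrow> bool"
  where "cp_admissible P \<longleftrightarrow>
    P \<noteq> {} \<and> (\<forall>x\<in>P. \<forall>J. J \<subseteq> supp x \<longrightarrow> coord_proj J x \<in> P)"

end

theory Submission
  imports Defs
begin

text \<open>
  Coordinate projections are linear and commute, and projecting to \<open>J\<close> only depends on
  \<open>J \<inter> supp x\<close>; this gives (i)--(iii). For (iv), let \<open>x \<in> P\<close> have maximal support \<open>S\<close>. If some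
  \<open>y \<in> P\<close> had a nonzero coordinate \<open>j \<notin> S\<close>, the midpoint of \<open>x\<close> and the projection of \<open>y\<close> to the
  \<open>j\<close>-axis would lie in \<open>P\<close> and have support \<open>S \<union> {j}\<close>. So \<open>P\<close> lies in the coordinate subspace
  of \<open>S\<close>, which is spanned by the projections of \<open>x\<close> to the axes in \<open>S\<close>; since \<open>0 \<in> P\<close>, the
  affine and the linear dimension of \<open>P\<close> agree.
\<close>

lemma coord_proj_nth [simp]: "coord_proj I x $ i = (if i \<in> I then x $ i else 0)"
  by (simp add: coord_proj_def)

lemma mem_supp_iff [simp]: "i \<in> supp x \<longleftrightarrow> x $ i \<noteq> 0"
  by (simp add: supp_def)

lemma coord_proj_scaleR: "coord_proj I (c *\<^sub>R x) = c *\<^sub>R coord_proj I x"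
  by (simp add: vec_eq_iff)

lemma coord_proj_add: "coord_proj I (x + y) = coord_proj I x + coord_proj I y"
  by (simp add: vec_eq_iff)

lemma coord_proj_commute: "coord_proj I (coord_proj J x) = coord_proj J (coord_proj I x)"
  by (simp add: vec_eq_iff)

lemma coord_proj_Int_supp: "coord_proj (J \<inter> supp x) x = coord_proj J x"
  by (simp add: vec_eq_iff)

lemma coord_proj_empty: "coord_proj {} x = 0"
  by (simp add: vec_eq_iff)

lemma coord_proj_singleton: "coord_proj {i} x = (x $ i) *\<^sub>R axis i 1"
  by (simp add: vec_eq_iff axis_def)

lemma cp_admissible_iff:
  "cp_admissible P \<longleftrightarrow> P \<noteq> {} \<and> (\<forall>x\<in>P. \<forall>J. coord_proj J x \<in> P)"
  unfolding cp_admissible_def by (metis coord_proj_Int_supp inf_le2)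

lemma cp_admissible_coord_proj: "cp_admissible P \<Longrightarrow> x \<in> P \<Longrightarrow> coord_proj J x \<in> P"
  by (simp add: cp_admissible_iff)

lemma cp_admissible_zero: "cp_admissible P \<Longrightarrow> 0 \<in> P"
  by (metis coord_proj_empty cp_admissible_iff ex_in_conv)

lemma cp_admissible_scaleR: "cp_admissible P \<Longrightarrow> cp_admissible ((\<lambda>x. c *\<^sub>R x) ` P)"
  by (auto simp: cp_admissible_iff coord_proj_scaleR)

lemma cp_admissible_scaleR_iff:
  assumes "c \<noteq> 0"
  shows "cp_admissible ((\<lambda>x. c *\<^sub>R x) ` P) \<longleftrightarrow> cp_admissible P"
proof
  assume "cp_admissible ((\<lambda>x. c *\<^sub>R x) ` P)"
  \<comment> \<open>Scaling back by \<open>inverse c\<close> reduces this direction to the other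
    one.\<close>
  then have "cp_admissible ((\<lambda>x. inverse c *\<^sub>R x) ` (\<lambda>x. c *\<^sub>R x) ` P)"
    by (rule cp_admissible_scaleR)
  then show "cp_admissible P"
    using assms by (simp add: image_image)
qed (rule cp_admissible_scaleR)

text \<open>The origin, as the projection to the empty index set, lies in every member and so
  witnesses that the intersection is nonempty.\<close>

lemma cp_admissible_Inter:
  assumes "\<And>P. P \<in> \<A> \<Longrightarrow> cp_admissible P"
  shows "cp_admissible (\<Inter>\<A>)"
proof -
  have "0 \<in> \<Inter>\<A>"
    using assms by (auto intro: cp_admissible_zero)
  moreover have "coord_proj J x \<in> \<Inter>\<A>" if "x \<in> \<Inter>\<A>" for x J
    using that assms by (auto intro: cp_admissible_coord_proj)
  ultimately show ?thesis
    unfolding cp_admissible_iff by blast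
qed

lemma cp_admissible_Union:
  assumes "\<A> \<noteq> {}" "\<And>P. P \<in> \<A> \<Longrightarrow> cp_admissible P"
  shows "cp_admissible (\<Union>\<A>)"
  using assms unfolding cp_admissible_iff by blast

lemma cp_admissible_plus:
  assumes "cp_admissible P" "cp_admissible Q"
  shows "cp_admissible (P + Q)"
  using assms unfolding cp_admissible_iff
  by (fastforce simp: coord_proj_add elim!: set_plus_elim intro: set_plus_intro)

lemma cp_admissible_coord_proj_image:
  assumes "cp_admissible P"
  shows "cp_admissible (coord_proj I ` P)"
  \<comment> \<open>Instantiated at \<open>I\<close>, the commutation law moves the projection to
    \<open>I\<close> outermost, which exhibits the result as the image of a point of
    \<open>P\<close>.\<close>
  using assms unfolding cp_admissible_iff by (auto simp: coord_proj_commute[of _ I])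

lemma vec_in_span_axis:
  fixes y :: "real ^ 'n"
  assumes "supp y \<subseteq> S"
  shows "y \<in> span ((\<lambda>i. axis i 1) ` S)"
proof -
  have "y = (\<Sum>i\<in>S. (y $ i) *\<^sub>R axis i 1)"
    using assms by (auto simp: vec_eq_iff axis_def if_distrib sum.delta cong: if_cong)
  also have "\<dots> \<in> span ((\<lambda>i. axis i 1) ` S)"
    by (intro span_sum span_scale span_base) auto
  finally show ?thesis .
qed

lemma supp_subset_of_card_max:
  fixes P :: "(real ^ 'n) set"
  assumes "convex P" "cp_admissible P" "x \<in> P" "y \<in> P"
    and max: "\<And>z. z \<in> P \<Longrightarrow> card (supp z) \<le> card (supp x)"
  shows "supp y \<subseteq> supp x"
proof (rule ccontr)
  assume "\<not> supp y \<subseteq> supp x"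
  then obtain j where j: "y $ j \<noteq> 0" "x $ j = 0"
    by auto
  \<comment> \<open>Projecting \<open>y\<close> first rules out cancellation: off \<open>j\<close>
    the point \<open>z\<close> is half of \<open>x\<close>, and at \<open>j\<close> it is half of
    \<open>y\<close>.\<close>
  define z where "z = (1/2) *\<^sub>R x + (1/2) *\<^sub>R coord_proj {j} y"
  have "z \<in> P"
    unfolding z_def using assms by (intro convexD cp_admissible_coord_proj) auto
  moreover have "supp z = insert j (supp x)"
    using j by (auto simp: z_def split: if_splits)
  ultimately show False
    using max[of z] j by simp
qed

lemma aff_dim_cp_admissible:
  fixes P :: "(real ^ 'n) set"
  assumes "convex P" "cp_admissible P" "x \<in> P"
    and "\<And>z. z \<in> P \<Longrightarrow> card (supp z) \<le> card (supp x)"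
  shows "aff_dim P = int (card (supp x))"
proof -
  let ?B = "(\<lambda>i. axis i 1 :: real ^ 'n) ` supp x"
  have "axis i 1 \<in> span P" if "i \<in> supp x" for i
  proof -
    \<comment> \<open>The projection lies in \<open>P\<close>; rescaling it to a unit vector may
      leave \<open>P\<close>, but not its span.\<close>
    have "inverse (x $ i) *\<^sub>R coord_proj {i} x \<in> span P"
      using assms by (intro span_scale span_base cp_admissible_coord_proj)
    then show ?thesis
      using that by (simp add: coord_proj_singleton)
  qed
  then have "?B \<subseteq> span P"
    by auto
  moreover have "P \<subseteq> span ?B"
    using supp_subset_of_card_max[OF assms(1-3) _ assms(4)] vec_in_span_axis by blast
  then have "span P \<subseteq> span ?B"
    by (simp add: span_minimal)
  moreover have "independent ?B"
    by (rule independent_mono[OF independent_Basis]) (auto simp: Basis_vec_def)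
  moreover have "card ?B = card (supp x)"
    by (intro card_image) (auto simp: inj_on_def axis_eq_axis)
  \<comment> \<open>So \<open>?B\<close>, a part of the standard basis, is a basis of
    \<open>span P\<close>.\<close>
  ultimately have "dim (span P) = card (supp x)"
    by (rule dim_unique)
  then show ?thesis
    using assms by (simp add: aff_dim_zero cp_admissible_zero hull_inc)
qed

lemma aff_dim_cp_admissible_Max:
  fixes P :: "(real ^ 'n) set"
  assumes "convex P" "cp_admissible P"
  shows "aff_dim P = int (Max {card (supp x) | x. x \<in> P})"
proof -
  let ?C = "{card (supp x) | x. x \<in> P}"
  \<comment> \<open>\<open>P\<close> may be infinite, but the support sizes are bounded by
    \<open>CARD('n)\<close>, so the maximum is attained.\<close>
  have "finite ?C"
    by (rule finite_subset[of _ "{..CARD('n)}"]) (auto intro: card_mono)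
  moreover have "?C \<noteq> {}"
    using assms(2) by (auto simp: cp_admissible_def)
  ultimately obtain x where x: "x \<in> P" "Max ?C = card (supp x)"
    using Max_in[of ?C] by auto
  moreover have "card (supp z) \<le> card (supp x)" if "z \<in> P" for z
    using Max_ge[OF \<open>finite ?C\<close>] that x(2) by (metis (mono_tags, lifting) mem_Collect_eq)
  ultimately show ?thesis
    using aff_dim_cp_admissible[OF assms x(1)] by simp
qed

theorem proposition4p1:
  shows "(\<forall>(P :: (real ^ 'n) set) (c :: real). c \<noteq> 0 \<longrightarrow>
            (cp_admissible P \<longleftrightarrow> cp_admissible ((\<lambda>x. c *\<^sub>R x) ` P)))
       \<and> (\<forall>\<A> :: (real ^ 'n) set set. \<A> \<noteq> {} \<and> (\<forall>P\<in>\<A>. cp_admissible P) \<longrightarrow>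
            cp_admissible (\<Inter>\<A>) \<and> cp_admissible (\<Union>\<A>))
       \<and> (\<forall>(P :: (real ^ 'n) set) Q. cp_admissible P \<and> cp_admissible Q \<longrightarrow>
            cp_admissible (P + Q))
       \<and> (\<forall>(P :: (real ^ 'n) set) (I :: 'n set). cp_admissible P \<longrightarrow>
            cp_admissible (coord_proj I ` P))
       \<and> (\<forall>P :: (real ^ 'n) set. convex P \<and> cp_admissible P \<longrightarrow>
            aff_dim P = int (Max {card (supp x) | x. x \<in> P}))"
  by (auto simp: cp_admissible_scaleR_iff cp_admissible_plus cp_admissible_coord_proj_image
      aff_dim_cp_admissible_Max intro: cp_admissible_Inter cp_admissible_Union)

end
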